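(* Let $n\geq 2$, let $A=A_{1}\times A_{2}\times\cdots\times A_{n}$, where $A_1,\dots,A_n$ are commutative rings with nonzero identity, and let $M=M_{1}\times M_{2}\times\cdots\times M_{n}$ be the $A$-module where $M_{i}$ is an $A_{i}$-module for every $1\leq i\leq n$. For a proper submodule $P$ of $M$, the following statements are equivalent. (i) $P$ is a classical 1-absorbing prime submodule of $M$. (ii) $P=\prod_{i=1}^{n}P_{i}$, where each $P_i$ is a submodule of $M_i$, such that for some $k\in\{1,2,\ldots,n\}$, $P_{k}$ is a classical prime submodule of $M_{k}$ and $P_{t}=M_{t}$ for every $t\in\{1,2,\ldots,n\}\setminus\{k\}$. (iii) $P$ is a classical prime submodule of $M$.
   Context: All rings are commutative with nonzero identity; the given modules are nonzero and unital; $A$ acts on $M$ componentwise. For a ring $A$ and an $A$-module $M$: a proper submodule $P$ of $M$ is a classical prime submodule if whenever $abm\in P$ for $a,b\in A$ and $m\in M$, then $am\in P$ or $bm\in P$; it is a classical 1-absorbing prime submodule if whenever $abcm\in P$ for nonunits $a,b,c\in A$ and $m\in M$, then $abm\in P$ or $cm\in P$. *)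

theory Defs
  imports "HOL-Algebra.Algebra"
begin

definition classical_prime_submodule ::
    "'b set \<Rightarrow> ('a, 'r) ring_scheme \<Rightarrow> ('a, 'b, 'm) module_scheme \<Rightarrow> bool"
  where "classical_prime_submodule P R M \<longleftrightarrow>
    submodule P R M \<and> P \<noteq> carrier M \<and>
    (\<forall>a\<in>carrier R. \<forall>b\<in>carrier R. \<forall>m\<in>carrier M.
      (a \<otimes>\<^bsub>R\<^esub> b) \<odot>\<^bsub>M\<^esub> m \<in> P \<longrightarrow> a \<odot>\<^bsub>M\<^esub> m \<in> P \<or> b \<odot>\<^bsub>M\<^esub> m \<in> P)"

definition classical_1_absorbing_prime_submodule ::
    "'b set \<Rightarrow> ('a, 'r) ring_scheme \<Rightarrow> ('a, 'b, 'm) module_scheme \<Rightarrow> bool"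
  where "classical_1_absorbing_prime_submodule P R M \<longleftrightarrow>
    submodule P R M \<and> P \<noteq> carrier M \<and>
    (\<forall>a\<in>carrier R - Units R. \<forall>b\<in>carrier R - Units R. \<forall>c\<in>carrier R - Units R. \<forall>m\<in>carrier M.
      (a \<otimes>\<^bsub>R\<^esub> b \<otimes>\<^bsub>R\<^esub> c) \<odot>\<^bsub>M\<^esub> m \<in> P \<longrightarrow> (a \<otimes>\<^bsub>R\<^esub> b) \<odot>\<^bsub>M\<^esub> m \<in> P \<or> c \<odot>\<^bsub>M\<^esub> m \<in> P)"

text \<open>
  Products of families of rings and modules, in the style of \<^const>\<open>product_group\<close>.
  The elements are functions that are extensional on the index set.
\<close>

definition product_ring :: "'i set \<Rightarrow> ('i \<Rightarrow> ('a, 'r) ring_scheme) \<Rightarrow> ('i \<Rightarrow> 'a) ring"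
  where "product_ring I R =
    \<lparr>carrier = (\<Pi>\<^sub>E i\<in>I. carrier (R i)),
     monoid.mult = (\<lambda>x y. \<lambda>i\<in>I. x i \<otimes>\<^bsub>R i\<^esub> y i),
     monoid.one = (\<lambda>i\<in>I. \<one>\<^bsub>R i\<^esub>),
     ring.zero = (\<lambda>i\<in>I. \<zero>\<^bsub>R i\<^esub>),
     ring.add = (\<lambda>x y. \<lambda>i\<in>I. x i \<oplus>\<^bsub>R i\<^esub> y i)\<rparr>"

text \<open>
  The record type of modules extends that of rings, so it also carries a multiplication and a
  unit; these two fields play no role for modules.
\<close>

definition product_module ::
    "'i set \<Rightarrow> ('i \<Rightarrow> ('a, 'b, 'm) module_scheme) \<Rightarrow> ('i \<Rightarrow> 'a, 'i \<Rightarrow> 'b) module"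
  where "product_module I M =
    ring.extend (product_ring I M) \<lparr>smult = (\<lambda>a x. \<lambda>i\<in>I. a i \<odot>\<^bsub>M i\<^esub> x i)\<rparr>"

lemma product_ring_simps [simp]:
  "carrier (product_ring I R) = (\<Pi>\<^sub>E i\<in>I. carrier (R i))"
  "x \<otimes>\<^bsub>product_ring I R\<^esub> y = (\<lambda>i\<in>I. x i \<otimes>\<^bsub>R i\<^esub> y i)"
  "\<one>\<^bsub>product_ring I R\<^esub> = (\<lambda>i\<in>I. \<one>\<^bsub>R i\<^esub>)"
  "\<zero>\<^bsub>product_ring I R\<^esub> = (\<lambda>i\<in>I. \<zero>\<^bsub>R i\<^esub>)"
  "x \<oplus>\<^bsub>product_ring I R\<^esub> y = (\<lambda>i\<in>I. x i \<oplus>\<^bsub>R i\<^esub> y i)"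
  by (simp_all add: product_ring_def)

lemma product_module_simps [simp]:
  "carrier (product_module I M) = (\<Pi>\<^sub>E i\<in>I. carrier (M i))"
  "\<zero>\<^bsub>product_module I M\<^esub> = (\<lambda>i\<in>I. \<zero>\<^bsub>M i\<^esub>)"
  "x \<oplus>\<^bsub>product_module I M\<^esub> y = (\<lambda>i\<in>I. x i \<oplus>\<^bsub>M i\<^esub> y i)"
  "a \<odot>\<^bsub>product_module I M\<^esub> x = (\<lambda>i\<in>I. a i \<odot>\<^bsub>M i\<^esub> x i)"
  by (simp_all add: product_module_def product_ring_def ring.defs)

lemma abelian_group_product_ring:
  assumes "\<And>i. i \<in> I \<Longrightarrow> abelian_group (R i)"
  shows "abelian_group (product_ring I R)"
proof (rule abelian_groupI)
  fix x assume x: "x \<in> carrier (product_ring I R)"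
  show "\<exists>y\<in>carrier (product_ring I R). y \<oplus>\<^bsub>product_ring I R\<^esub> x = \<zero>\<^bsub>product_ring I R\<^esub>"
    by (rule bexI [where x = "\<lambda>i\<in>I. \<ominus>\<^bsub>R i\<^esub> x i"])
      (use assms x in \<open>auto simp: PiE_iff abelian_group.l_neg abelian_group.a_inv_closed
        intro!: restrict_ext\<close>)
qed (use assms in \<open>auto simp: PiE_iff fun_eq_iff extensional_def abelian_groupE(1,2,5)
      intro: abelian_groupE(3,4)\<close>)

lemma cring_product_ring:
  assumes "\<And>i. i \<in> I \<Longrightarrow> cring (R i)"
  shows "cring (product_ring I R)"
proof (rule cringI)
  show "abelian_group (product_ring I R)"
    using assms by (intro abelian_group_product_ring) (simp add: cring_def ring_def)
  show "Group.comm_monoid (product_ring I R)"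
    by (rule comm_monoidI)
      (use assms in \<open>auto simp: PiE_iff fun_eq_iff extensional_def cring.cring_simprules(5,6,12)
        intro: cring.cring_simprules(11,14)\<close>)
qed (use assms in \<open>auto simp: PiE_iff fun_eq_iff extensional_def cring.cring_simprules(13)\<close>)

lemma abelian_group_product_module:
  assumes "\<And>i. i \<in> I \<Longrightarrow> abelian_group (M i)"
  shows "abelian_group (product_module I M)"
proof (rule abelian_groupI)
  fix x assume x: "x \<in> carrier (product_module I M)"
  show "\<exists>y\<in>carrier (product_module I M).
      y \<oplus>\<^bsub>product_module I M\<^esub> x = \<zero>\<^bsub>product_module I M\<^esub>"
    by (rule bexI [where x = "\<lambda>i\<in>I. \<ominus>\<^bsub>M i\<^esub> x i"])
      (use assms x in \<open>auto simp: PiE_iff abelian_group.l_neg abelian_group.a_inv_closed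
        intro!: restrict_ext\<close>)
qed (use assms in \<open>auto simp: PiE_iff fun_eq_iff extensional_def abelian_groupE(1,2,5)
      intro: abelian_groupE(3,4)\<close>)

lemma module_product_module:
  assumes "\<And>i. i \<in> I \<Longrightarrow> module (R i) (M i)"
  shows "module (product_ring I R) (product_module I M)"
proof (rule moduleI)
  show "cring (product_ring I R)"
    using assms by (intro cring_product_ring) (simp add: module_def)
  show "abelian_group (product_module I M)"
    using assms by (intro abelian_group_product_module) (simp add: module_def)
qed (auto simp: PiE_iff fun_eq_iff extensional_def module.smult_closed [OF assms]
    module.smult_l_distr [OF assms] module.smult_r_distr [OF assms]
    module.smult_assoc1 [OF assms] module.smult_one [OF assms])

end

theory Submission
  imports Defs
begin

text \<open>
  The implication from prime to 1-absorbing prime is the prime condition read at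
  \<open>a \<otimes> b\<close> and \<open>c\<close>. The converse fails for general rings, but it
  holds as soon as \<open>\<one>\<close> is a sum of two nonunits \<open>e\<close> and \<open>f\<close>. Indeed, let
  \<open>a b m \<in> P\<close> with \<open>a\<close> and \<open>b\<close> nonunits and \<open>b m \<notin> P\<close>. The 1-absorbing condition, applied to the
  products \<open>e a b\<close> and \<open>f a b\<close>, puts both \<open>e a m\<close> and \<open>f a m\<close> into \<open>P\<close>, and they sum to \<open>a m\<close>
  (\<open>classical_1_absorbing_prime_imp_prime\<close>).
  A product of at least two nonzero rings is such a ring: a coordinate idempotent and its
  complement are nonunits with sum \<open>\<one>\<close>.

  For the shape of the classical prime submodules of a finite product, the key fact is that
  complementary idempotents \<open>e\<close> and \<open>\<one> - e\<close> have product \<open>\<zero>\<close>, so that for every \<open>m\<close> a classical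
  prime \<open>P\<close> contains \<open>e m\<close> or \<open>(\<one> - e) m\<close>. Take \<open>x \<notin> P\<close>. Since \<open>x\<close> is the finite sum
  of its coordinate parts, some part of it, say the \<open>k\<close>-th, lies outside \<open>P\<close>. Attaching to this part
  arbitrary entries at the other indices shows that \<open>P\<close> contains every element vanishing at \<open>k\<close>
  (\<open>classical_prime_contains_kernel_of_projection\<close>).
  Hence \<open>P\<close> is the preimage of its \<open>k\<close>-th projection. Being classical prime transfers in both
  directions between a submodule of the \<open>k\<close>-th factor and its preimage, because the
  projections of rings and of modules are surjective (\<open>classical_prime_preimage_iff\<close>).
\<close>

section \<open>Classical prime and classical 1-absorbing prime submodules\<close>

lemma (in module) classical_prime_imp_1_absorbing_prime:
  assumes "classical_prime_submodule P R M"
  shows "classical_1_absorbing_prime_submodule P R M"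
  using assms
  unfolding classical_prime_submodule_def classical_1_absorbing_prime_submodule_def by blast

text \<open>
  Units need a separate argument, since the 1-absorbing condition says nothing about them: if
  \<open>a\<close> is a unit, then \<open>a b m \<in> P\<close> gives \<open>b m \<in> P\<close> after multiplication by the inverse of \<open>a\<close>.
\<close>

lemma (in module) submodule_unit_cancel:
  assumes P: "submodule P R M" and a: "a \<in> Units R" and y: "y \<in> carrier M" and ay: "a \<odot>\<^bsub>M\<^esub> y \<in> P"
  shows "y \<in> P"
proof -
  have "inv a \<odot>\<^bsub>M\<^esub> (a \<odot>\<^bsub>M\<^esub> y) \<in> P"
    using submoduleE(4)[OF P _ ay] a by simp
  moreover have "inv a \<odot>\<^bsub>M\<^esub> (a \<odot>\<^bsub>M\<^esub> y) = y"
    using a y smult_assoc1[of "inv a" a y] R.Units_closed[OF a] by simp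
  ultimately show ?thesis by simp
qed

text \<open>
  The hypothesis on \<open>e\<close> and \<open>f\<close> says that the ring is not local. The argument is that of the opening
  comment, applied at each fixed \<open>m\<close> to the ideal of all \<open>a\<close> with \<open>a m \<in> P\<close>.
\<close>

lemma (in module) classical_1_absorbing_prime_imp_prime:
  assumes P: "classical_1_absorbing_prime_submodule P R M"
    and e: "e \<in> carrier R - Units R" and f: "f \<in> carrier R - Units R" and ef: "e \<oplus> f = \<one>"
  shows "classical_prime_submodule P R M"
proof -
  have sub: "submodule P R M" and proper: "P \<noteq> carrier M"
    and absorb: "\<And>a b c m. \<lbrakk>a \<in> carrier R - Units R; b \<in> carrier R - Units R;
        c \<in> carrier R - Units R; m \<in> carrier M; (a \<otimes> b \<otimes> c) \<odot>\<^bsub>M\<^esub> m \<in> P\<rbrakk>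
        \<Longrightarrow> (a \<otimes> b) \<odot>\<^bsub>M\<^esub> m \<in> P \<or> c \<odot>\<^bsub>M\<^esub> m \<in> P"
    using P unfolding classical_1_absorbing_prime_submodule_def by blast+
  have "a \<odot>\<^bsub>M\<^esub> m \<in> P \<or> b \<odot>\<^bsub>M\<^esub> m \<in> P"
    if a: "a \<in> carrier R" and b: "b \<in> carrier R" and m: "m \<in> carrier M"
      and abm: "(a \<otimes> b) \<odot>\<^bsub>M\<^esub> m \<in> P" for a b m
  proof -
    consider "a \<in> Units R" | "b \<in> Units R" | "a \<notin> Units R" "b \<notin> Units R" by blast
    then show ?thesis
    proof cases
      case 1
      have "a \<odot>\<^bsub>M\<^esub> (b \<odot>\<^bsub>M\<^esub> m) \<in> P" using abm a b m by (simp add: smult_assoc1)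
      then show ?thesis using submodule_unit_cancel[OF sub 1] b m by blast
    next
      case 2
      have "b \<odot>\<^bsub>M\<^esub> (a \<odot>\<^bsub>M\<^esub> m) \<in> P" using abm a b m by (simp add: R.m_comm flip: smult_assoc1)
      then show ?thesis using submodule_unit_cancel[OF sub 2] a m by blast
    next
      case 3
      have multiple: "(c \<otimes> a) \<odot>\<^bsub>M\<^esub> m \<in> P \<or> b \<odot>\<^bsub>M\<^esub> m \<in> P" if c: "c \<in> carrier R - Units R" for c
      proof (rule absorb)
        have "c \<odot>\<^bsub>M\<^esub> ((a \<otimes> b) \<odot>\<^bsub>M\<^esub> m) \<in> P" using submoduleE(4)[OF sub _ abm] c by blast
        then show "(c \<otimes> a \<otimes> b) \<odot>\<^bsub>M\<^esub> m \<in> P" using a b c m by (simp add: R.m_assoc smult_assoc1)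
      qed (use a b c m 3 in auto)
      have "(e \<otimes> a) \<odot>\<^bsub>M\<^esub> m \<oplus>\<^bsub>M\<^esub> (f \<otimes> a) \<odot>\<^bsub>M\<^esub> m = a \<odot>\<^bsub>M\<^esub> m"
        using a m e f ef by (simp flip: smult_l_distr R.l_distr)
      then show ?thesis using multiple[OF e] multiple[OF f] submoduleE(5)[OF sub] by metis
    qed
  qed
  then show ?thesis using sub proper unfolding classical_prime_submodule_def by blast
qed

section \<open>Coordinate idempotents of a product\<close>

text \<open>
  The \<open>J\<close>-part of a family replaces its entries outside \<open>J\<close> by zero. As module records extend ring
  records, this one function serves for rings and for modules. The \<open>J\<close>-part of
  the unit family is the idempotent whose action on a product module takes \<open>J\<close>-parts.
\<close>

definition part :: "'i set \<Rightarrow> ('i \<Rightarrow> ('a, 'r) ring_scheme) \<Rightarrow> 'i set \<Rightarrow> ('i \<Rightarrow> 'a) \<Rightarrow> 'i \<Rightarrow> 'a"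
  where "part I R J x = (\<lambda>i\<in>I. if i \<in> J then x i else \<zero>\<^bsub>R i\<^esub>)"

locale product_of_modules =
  fixes I :: "'i set"
    and R :: "'i \<Rightarrow> ('a, 'r) ring_scheme"
    and M :: "'i \<Rightarrow> ('a, 'b, 'm) module_scheme"
  assumes component_module: "\<And>i. i \<in> I \<Longrightarrow> module (R i) (M i)"
begin

sublocale prod: module "product_ring I R" "product_module I M"
  by (rule module_product_module) (rule component_module)

lemma component_cring: "i \<in> I \<Longrightarrow> cring (R i)"
  using component_module module.axioms(1) by blast

lemma component_zero:
  assumes "i \<in> I"
  shows "\<zero>\<^bsub>R i\<^esub> \<in> carrier (R i)" "\<zero>\<^bsub>M i\<^esub> \<in> carrier (M i)"
proof -
  interpret module "R i" "M i" using assms by (rule component_module)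
  show "\<zero>\<^bsub>R i\<^esub> \<in> carrier (R i)" "\<zero>\<^bsub>M i\<^esub> \<in> carrier (M i)" by auto
qed

lemma part_closed:
  assumes "x \<in> carrier (product_module I M)"
  shows "part I M J x \<in> carrier (product_module I M)"
  using assms component_zero by (auto simp: part_def PiE_iff)

lemma idempotent_closed: "part I R J (\<lambda>i. \<one>\<^bsub>R i\<^esub>) \<in> carrier (product_ring I R)"
proof -
  have "\<one>\<^bsub>R i\<^esub> \<in> carrier (R i)" if "i \<in> I" for i
    using component_cring[OF that] by (rule cring.cring_simprules(6))
  then show ?thesis using component_zero by (auto simp: part_def)
qed

lemma idempotent_smult:
  assumes "x \<in> carrier (product_module I M)"
  shows "part I R J (\<lambda>i. \<one>\<^bsub>R i\<^esub>) \<odot>\<^bsub>product_module I M\<^esub> x = part I M J x"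
  using assms
  by (auto simp: part_def PiE_iff fun_eq_iff module.smult_one[OF component_module]
      module.smult_l_null[OF component_module])

lemma submodule_part:
  assumes P: "submodule P (product_ring I R) (product_module I M)" and x: "x \<in> P"
  shows "part I M J x \<in> P"
proof -
  have "x \<in> carrier (product_module I M)" using prod.submoduleE(1)[OF P] x by blast
  then show ?thesis
    using prod.submoduleE(4)[OF P idempotent_closed x] by (simp only: idempotent_smult)
qed

lemma part_add_disjoint:
  assumes "x \<in> carrier (product_module I M)" and "J \<inter> K = {}"
  shows "part I M J x \<oplus>\<^bsub>product_module I M\<^esub> part I M K x = part I M (J \<union> K) x"
proof (rule ext)
  fix i
  show "(part I M J x \<oplus>\<^bsub>product_module I M\<^esub> part I M K x) i = part I M (J \<union> K) x i"
  proof (cases "i \<in> I")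
    case True
    interpret module "R i" "M i" using True by (rule component_module)
    have "x i \<in> carrier (M i)" using assms(1) True by auto
    then show ?thesis using True assms(2) by (auto simp: part_def)
  qed (simp add: part_def)
qed

lemma part_all: "x \<in> carrier (product_module I M) \<Longrightarrow> part I M I x = x"
  by (auto simp: part_def PiE_iff extensional_def)

text \<open>
  At an index outside \<open>J\<close> the idempotent has entry \<open>\<zero>\<close>, so invertibility would force \<open>\<zero> = \<one>\<close> there.
\<close>

lemma idempotent_not_unit:
  assumes i: "i \<in> I" "i \<notin> J" and nontrivial: "\<one>\<^bsub>R i\<^esub> \<noteq> \<zero>\<^bsub>R i\<^esub>"
  shows "part I R J (\<lambda>i. \<one>\<^bsub>R i\<^esub>) \<notin> Units (product_ring I R)"
proof
  assume "part I R J (\<lambda>i. \<one>\<^bsub>R i\<^esub>) \<in> Units (product_ring I R)"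
  then obtain y where y: "y \<in> carrier (product_ring I R)"
    and inverse: "y \<otimes>\<^bsub>product_ring I R\<^esub> part I R J (\<lambda>i. \<one>\<^bsub>R i\<^esub>) = \<one>\<^bsub>product_ring I R\<^esub>"
    unfolding Units_def by blast
  interpret cring "R i" using i(1) by (rule component_cring)
  have "y i \<in> carrier (R i)" using y i by auto
  moreover have "y i \<otimes>\<^bsub>R i\<^esub> \<zero>\<^bsub>R i\<^esub> = \<one>\<^bsub>R i\<^esub>"
    using fun_cong[OF inverse, of i] i by (simp add: part_def)
  ultimately show False using nontrivial by simp
qed

lemma idempotents_add_one:
  "part I R J (\<lambda>i. \<one>\<^bsub>R i\<^esub>) \<oplus>\<^bsub>product_ring I R\<^esub> part I R (I - J) (\<lambda>i. \<one>\<^bsub>R i\<^esub>) = \<one>\<^bsub>product_ring I R\<^esub>"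
proof (rule ext)
  fix i
  show "(part I R J (\<lambda>i. \<one>\<^bsub>R i\<^esub>) \<oplus>\<^bsub>product_ring I R\<^esub> part I R (I - J) (\<lambda>i. \<one>\<^bsub>R i\<^esub>)) i
      = \<one>\<^bsub>product_ring I R\<^esub> i"
  proof (cases "i \<in> I")
    case True
    interpret cring "R i" using True by (rule component_cring)
    show ?thesis using True by (simp add: part_def)
  qed (simp add: part_def)
qed

theorem classical_1_absorbing_prime_iff_prime:
  assumes ij: "i \<in> I" "j \<in> I" "i \<noteq> j"
    and nontrivial: "\<one>\<^bsub>R i\<^esub> \<noteq> \<zero>\<^bsub>R i\<^esub>" "\<one>\<^bsub>R j\<^esub> \<noteq> \<zero>\<^bsub>R j\<^esub>"
  shows "classical_1_absorbing_prime_submodule P (product_ring I R) (product_module I M)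
    \<longleftrightarrow> classical_prime_submodule P (product_ring I R) (product_module I M)"
proof
  assume "classical_1_absorbing_prime_submodule P (product_ring I R) (product_module I M)"
  then show "classical_prime_submodule P (product_ring I R) (product_module I M)"
  proof (rule prod.classical_1_absorbing_prime_imp_prime)
    show "part I R {i} (\<lambda>i. \<one>\<^bsub>R i\<^esub>) \<in> carrier (product_ring I R) - Units (product_ring I R)"
      using idempotent_closed idempotent_not_unit[of j "{i}"] assms by blast
    show "part I R (I - {i}) (\<lambda>i. \<one>\<^bsub>R i\<^esub>) \<in> carrier (product_ring I R) - Units (product_ring I R)"
      using idempotent_closed idempotent_not_unit[of i "I - {i}"] assms by blast
  qed (rule idempotents_add_one)
qed (rule prod.classical_prime_imp_1_absorbing_prime)

section \<open>Projections to a factor\<close>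

lemma module_element_with_entry:
  assumes "k \<in> I" "y \<in> carrier (M k)"
  obtains x where "x \<in> carrier (product_module I M)" "x k = y"
proof
  show "(\<lambda>i\<in>I. if i = k then y else \<zero>\<^bsub>M i\<^esub>) \<in> carrier (product_module I M)"
    using assms component_zero by auto
qed (use assms in simp)

lemma ring_element_with_entry:
  assumes "k \<in> I" "a \<in> carrier (R k)"
  obtains s where "s \<in> carrier (product_ring I R)" "s k = a"
proof
  show "(\<lambda>i\<in>I. if i = k then a else \<zero>\<^bsub>R i\<^esub>) \<in> carrier (product_ring I R)"
    using assms component_zero by auto
qed (use assms in simp)

lemma projection_submodule:
  assumes P: "submodule P (product_ring I R) (product_module I M)" and k: "k \<in> I"
  shows "submodule ((\<lambda>x. x k) ` P) (R k) (M k)"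
proof -
  interpret Mk: module "R k" "M k" using k by (rule component_module)
  note subset = prod.submoduleE(1)[OF P]
  have subset_k: "(\<lambda>x. x k) ` P \<subseteq> carrier (M k)" using subset k by auto
  have scaled: "a \<odot>\<^bsub>M k\<^esub> y \<in> (\<lambda>x. x k) ` P"
    if a: "a \<in> carrier (R k)" and y: "y \<in> (\<lambda>x. x k) ` P" for a y
  proof -
    obtain x where x: "x \<in> P" "y = x k" using y by blast
    obtain s where s: "s \<in> carrier (product_ring I R)" "s k = a"
      using ring_element_with_entry[OF k a] .
    then have "s \<odot>\<^bsub>product_module I M\<^esub> x \<in> P" using prod.submoduleE(4)[OF P _ x(1)] by blast
    moreover have "(s \<odot>\<^bsub>product_module I M\<^esub> x) k = a \<odot>\<^bsub>M k\<^esub> y"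
      using k x s by simp
    ultimately show ?thesis by (metis image_eqI)
  qed
  show ?thesis
  proof (rule Mk.submoduleI)
    show "(\<lambda>x. x k) ` P \<subseteq> carrier (M k)" by (rule subset_k)
    obtain x where "x \<in> P" using prod.submoduleE(2)[OF P] by blast
    then have "\<zero>\<^bsub>R k\<^esub> \<odot>\<^bsub>M k\<^esub> x k \<in> (\<lambda>x. x k) ` P" by (intro scaled) auto
    then show "\<zero>\<^bsub>M k\<^esub> \<in> (\<lambda>x. x k) ` P" using subset_k \<open>x \<in> P\<close> by (simp add: image_subset_iff)
  next
    fix y assume y: "y \<in> (\<lambda>x. x k) ` P"
    have "(\<ominus>\<^bsub>R k\<^esub> \<one>\<^bsub>R k\<^esub>) \<odot>\<^bsub>M k\<^esub> y \<in> (\<lambda>x. x k) ` P" by (rule scaled) (use y in auto)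
    then show "\<ominus>\<^bsub>M k\<^esub> y \<in> (\<lambda>x. x k) ` P"
      using subset_k y by (simp add: Mk.smult_l_minus subset_iff)
  next
    fix y z assume "y \<in> (\<lambda>x. x k) ` P" "z \<in> (\<lambda>x. x k) ` P"
    then obtain u v where "u \<in> P" "y = u k" "v \<in> P" "z = v k" by blast
    moreover from this have "u \<oplus>\<^bsub>product_module I M\<^esub> v \<in> P" using prod.submoduleE(5)[OF P] by blast
    moreover have "(u \<oplus>\<^bsub>product_module I M\<^esub> v) k = u k \<oplus>\<^bsub>M k\<^esub> v k" using k by simp
    ultimately show "y \<oplus>\<^bsub>M k\<^esub> z \<in> (\<lambda>x. x k) ` P" by (metis image_eqI)
  qed (rule scaled)
qed

text \<open>
  Every condition that enters the definition only looks at the \<open>k\<close>-th entries, which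
  can be prescribed freely.
\<close>

lemma classical_prime_preimage_iff:
  assumes k: "k \<in> I"
    and P: "submodule P (product_ring I R) (product_module I M)"
    and Q: "submodule Q (R k) (M k)"
    and preimage: "\<And>x. x \<in> carrier (product_module I M) \<Longrightarrow> x \<in> P \<longleftrightarrow> x k \<in> Q"
  shows "classical_prime_submodule P (product_ring I R) (product_module I M)
    \<longleftrightarrow> classical_prime_submodule Q (R k) (M k)"
proof -
  note Q_subset = module.submoduleE(1)[OF component_module[OF k] Q]
  note P_subset = prod.submoduleE(1)[OF P]
  have entry: "x k \<in> carrier (M k)" if "x \<in> carrier (product_module I M)" for x
    using that k by auto
  have ring_entry: "s k \<in> carrier (R k)" if "s \<in> carrier (product_ring I R)" for s
    using that k by auto
  have scaled: "s \<odot>\<^bsub>product_module I M\<^esub> x \<in> P \<longleftrightarrow> s k \<odot>\<^bsub>M k\<^esub> x k \<in> Q"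
    if "s \<in> carrier (product_ring I R)" "x \<in> carrier (product_module I M)" for s x
    using preimage[OF prod.smult_closed[OF that]] k by simp
  have scaled2: "(s \<otimes>\<^bsub>product_ring I R\<^esub> t) \<odot>\<^bsub>product_module I M\<^esub> x \<in> P
      \<longleftrightarrow> (s k \<otimes>\<^bsub>R k\<^esub> t k) \<odot>\<^bsub>M k\<^esub> x k \<in> Q"
    if "s \<in> carrier (product_ring I R)" "t \<in> carrier (product_ring I R)"
      "x \<in> carrier (product_module I M)" for s t x
    using scaled[OF prod.R.m_closed[OF that(1,2)] that(3)] k by simp
  have proper: "P \<noteq> carrier (product_module I M) \<longleftrightarrow> Q \<noteq> carrier (M k)"
    using preimage entry module_element_with_entry[OF k] Q_subset P_subset
    by (metis subsetI subset_antisym)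
  show ?thesis
  proof
    assume prime: "classical_prime_submodule P (product_ring I R) (product_module I M)"
    have "a \<odot>\<^bsub>M k\<^esub> m \<in> Q \<or> b \<odot>\<^bsub>M k\<^esub> m \<in> Q"
      if "a \<in> carrier (R k)" "b \<in> carrier (R k)" "m \<in> carrier (M k)"
        "(a \<otimes>\<^bsub>R k\<^esub> b) \<odot>\<^bsub>M k\<^esub> m \<in> Q" for a b m
    proof -
      obtain s where s: "s \<in> carrier (product_ring I R)" "s k = a"
        using ring_element_with_entry[OF k \<open>a \<in> carrier (R k)\<close>] .
      obtain t where t: "t \<in> carrier (product_ring I R)" "t k = b"
        using ring_element_with_entry[OF k \<open>b \<in> carrier (R k)\<close>] .
      obtain x where x: "x \<in> carrier (product_module I M)" "x k = m"
        using module_element_with_entry[OF k \<open>m \<in> carrier (M k)\<close>] .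
      have "(s \<otimes>\<^bsub>product_ring I R\<^esub> t) \<odot>\<^bsub>product_module I M\<^esub> x \<in> P"
        using scaled2[OF s(1) t(1) x(1)] that(4) s(2) t(2) x(2) by blast
      then have "s \<odot>\<^bsub>product_module I M\<^esub> x \<in> P \<or> t \<odot>\<^bsub>product_module I M\<^esub> x \<in> P"
        using prime s(1) t(1) x(1) unfolding classical_prime_submodule_def by blast
      then show ?thesis using scaled[OF s(1) x(1)] scaled[OF t(1) x(1)] s(2) t(2) x(2) by blast
    qed
    then show "classical_prime_submodule Q (R k) (M k)"
      using prime Q proper unfolding classical_prime_submodule_def by blast
  next
    assume prime: "classical_prime_submodule Q (R k) (M k)"
    have "s \<odot>\<^bsub>product_module I M\<^esub> x \<in> P \<or> t \<odot>\<^bsub>product_module I M\<^esub> x \<in> P"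
      if s: "s \<in> carrier (product_ring I R)" and t: "t \<in> carrier (product_ring I R)"
        and x: "x \<in> carrier (product_module I M)"
        and st: "(s \<otimes>\<^bsub>product_ring I R\<^esub> t) \<odot>\<^bsub>product_module I M\<^esub> x \<in> P" for s t x
    proof -
      have "(s k \<otimes>\<^bsub>R k\<^esub> t k) \<odot>\<^bsub>M k\<^esub> x k \<in> Q" using st scaled2[OF s t x] by blast
      then have "s k \<odot>\<^bsub>M k\<^esub> x k \<in> Q \<or> t k \<odot>\<^bsub>M k\<^esub> x k \<in> Q"
        using prime ring_entry[OF s] ring_entry[OF t] entry[OF x]
        unfolding classical_prime_submodule_def by blast
      then show ?thesis using scaled[OF s x] scaled[OF t x] by blast
    qed
    then show "classical_prime_submodule P (product_ring I R) (product_module I M)"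
      using prime P proper unfolding classical_prime_submodule_def by blast
  qed
qed

section \<open>Classical prime submodules of a finite product\<close>

text \<open>The two idempotents of the parts in question have product \<open>\<zero>\<close>.\<close>

lemma classical_prime_complementary_parts:
  assumes prime: "classical_prime_submodule P (product_ring I R) (product_module I M)"
    and x: "x \<in> carrier (product_module I M)"
  shows "part I M J x \<in> P \<or> part I M (I - J) x \<in> P"
proof -
  let ?e = "\<lambda>J. part I R J (\<lambda>i. \<one>\<^bsub>R i\<^esub>)"
  have P: "submodule P (product_ring I R) (product_module I M)"
    using prime unfolding classical_prime_submodule_def by blast
  obtain p where p: "p \<in> P" using prod.submoduleE(2)[OF P] by blast
  have "\<zero>\<^bsub>product_ring I R\<^esub> \<odot>\<^bsub>product_module I M\<^esub> p = \<zero>\<^bsub>product_module I M\<^esub>"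
    using prod.submoduleE(1)[OF P] p by (intro prod.smult_l_null) blast
  then have zero: "\<zero>\<^bsub>product_module I M\<^esub> \<in> P"
    using prod.submoduleE(4)[OF P prod.R.zero_closed p] by metis
  have "(?e J \<otimes>\<^bsub>product_ring I R\<^esub> ?e (I - J)) \<odot>\<^bsub>product_module I M\<^esub> x
      = part I M J (part I M (I - J) x)"
    using x part_closed by (simp only: prod.smult_assoc1 idempotent_closed idempotent_smult)
  also have "\<dots> = \<zero>\<^bsub>product_module I M\<^esub>" by (auto simp: part_def)
  finally have "(?e J \<otimes>\<^bsub>product_ring I R\<^esub> ?e (I - J)) \<odot>\<^bsub>product_module I M\<^esub> x \<in> P"
    using zero by metis
  then have "?e J \<odot>\<^bsub>product_module I M\<^esub> x \<in> P \<or> ?e (I - J) \<odot>\<^bsub>product_module I M\<^esub> x \<in> P"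
    using prime x idempotent_closed unfolding classical_prime_submodule_def by blast
  then show ?thesis using idempotent_smult[OF x] by metis
qed

lemma submodule_mem_if_singleton_parts:
  assumes fin: "finite I"
    and P: "submodule P (product_ring I R) (product_module I M)"
    and x: "x \<in> carrier (product_module I M)"
    and singles: "\<And>i. i \<in> I \<Longrightarrow> part I M {i} x \<in> P"
  shows "x \<in> P"
proof -
  obtain p where p: "p \<in> P" using prod.submoduleE(2)[OF P] by blast
  have "part I M J x \<in> P" if "finite J" "J \<subseteq> I" for J
    using that
  proof (induction J rule: finite_induct)
    case empty
    have "part I M {} x = part I M {} p" by (simp add: part_def)
    then show ?case using submodule_part[OF P p] by metis
  next
    case (insert j J)
    then have "part I M {j} x \<oplus>\<^bsub>product_module I M\<^esub> part I M J x \<in> P"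
      using prod.submoduleE(5)[OF P] singles by blast
    moreover have "part I M {j} x \<oplus>\<^bsub>product_module I M\<^esub> part I M J x = part I M (insert j J) x"
      using part_add_disjoint[OF x, of "{j}" J] insert.hyps by simp
    ultimately show ?case by metis
  qed
  then show ?thesis using fin part_all[OF x] by (metis subset_refl)
qed

text \<open>
  The index \<open>k\<close> is one at which some \<open>x\<close> outside \<open>P\<close> has a part outside \<open>P\<close>. It does not depend on
  the \<open>y\<close> in the conclusion, because \<open>x\<close> can be glued to \<open>y\<close> along \<open>k\<close>.
\<close>

lemma classical_prime_contains_kernel_of_projection:
  assumes fin: "finite I"
    and prime: "classical_prime_submodule P (product_ring I R) (product_module I M)"
  obtains k where "k \<in> I"
    "\<And>y. y \<in> carrier (product_module I M) \<Longrightarrow> part I M (I - {k}) y \<in> P"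
proof -
  have P: "submodule P (product_ring I R) (product_module I M)"
    and proper: "P \<noteq> carrier (product_module I M)"
    using prime unfolding classical_prime_submodule_def by blast+
  obtain x where x: "x \<in> carrier (product_module I M)" "x \<notin> P"
    using proper prod.submoduleE(1)[OF P] by blast
  obtain k where k: "k \<in> I" "part I M {k} x \<notin> P"
    using submodule_mem_if_singleton_parts[OF fin P x(1)] x(2) by blast
  show ?thesis
  proof (rule that[OF k(1)])
    fix y assume y: "y \<in> carrier (product_module I M)"
    \<comment> \<open>The \<open>k\<close>-th part of this family is that of \<open>x\<close>, so primeness puts its other part into \<open>P\<close>.\<close>
    let ?z = "\<lambda>i\<in>I. if i = k then x i else y i"
    have "?z \<in> carrier (product_module I M)" using x(1) y by (auto simp: PiE_iff)
    then have "part I M {k} ?z \<in> P \<or> part I M (I - {k}) ?z \<in> P"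
      by (rule classical_prime_complementary_parts[OF prime])
    moreover have "part I M {k} ?z = part I M {k} x" "part I M (I - {k}) ?z = part I M (I - {k}) y"
      by (auto simp: part_def)
    ultimately show "part I M (I - {k}) y \<in> P" using k(2) by metis
  qed
qed

theorem classical_prime_iff_prime_in_one_factor:
  assumes fin: "finite I"
    and P: "submodule P (product_ring I R) (product_module I M)"
  shows "classical_prime_submodule P (product_ring I R) (product_module I M) \<longleftrightarrow>
    (\<exists>Q. (\<forall>i\<in>I. submodule (Q i) (R i) (M i)) \<and> P = (\<Pi>\<^sub>E i\<in>I. Q i) \<and>
      (\<exists>k\<in>I. classical_prime_submodule (Q k) (R k) (M k) \<and> (\<forall>t\<in>I - {k}. Q t = carrier (M t))))"
    (is "?prime \<longleftrightarrow> (\<exists>Q. ?product Q)")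
proof
  assume prime: ?prime
  note P_subset = prod.submoduleE(1)[OF P]
  obtain k where k: "k \<in> I"
    and kernel: "\<And>y. y \<in> carrier (product_module I M) \<Longrightarrow> part I M (I - {k}) y \<in> P"
    using classical_prime_contains_kernel_of_projection[OF fin prime] by blast
  define Q where "Q i = (if i = k then (\<lambda>x. x k) ` P else carrier (M i))" for i
  have Q: "submodule (Q i) (R i) (M i)" if "i \<in> I" for i
    using projection_submodule[OF P k] module.carrier_is_submodule[OF component_module[OF that]]
    by (simp add: Q_def)
  have preimage: "x \<in> P \<longleftrightarrow> x k \<in> Q k" if x: "x \<in> carrier (product_module I M)" for x
  proof
    assume "x k \<in> Q k"
    then obtain p where p: "p \<in> P" "x k = p k" by (auto simp: Q_def)
    have "part I M {k} x = part I M {k} p" using p(2) by (auto simp: part_def)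
    then have "part I M {k} x \<in> P" using submodule_part[OF P p(1)] by metis
    then have "part I M {k} x \<oplus>\<^bsub>product_module I M\<^esub> part I M (I - {k}) x \<in> P"
      using prod.submoduleE(5)[OF P] kernel[OF x] by blast
    moreover have "part I M {k} x \<oplus>\<^bsub>product_module I M\<^esub> part I M (I - {k}) x = x"
      using part_add_disjoint[OF x, of "{k}" "I - {k}"] part_all[OF x] k by (simp add: insert_absorb)
    ultimately show "x \<in> P" by metis
  qed (auto simp: Q_def)
  have "P = (\<Pi>\<^sub>E i\<in>I. Q i)"
  proof
    show "P \<subseteq> (\<Pi>\<^sub>E i\<in>I. Q i)" using P_subset by (fastforce simp: Q_def PiE_iff)
    show "(\<Pi>\<^sub>E i\<in>I. Q i) \<subseteq> P"
    proof
      fix x assume x: "x \<in> (\<Pi>\<^sub>E i\<in>I. Q i)"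
      have "Q i \<subseteq> carrier (M i)" if "i \<in> I" for i
        using module.submoduleE(1)[OF component_module[OF that] Q[OF that]] .
      then have "x \<in> carrier (product_module I M)" using x by (auto simp: PiE_iff)
      then show "x \<in> P" using preimage x k by (auto simp: PiE_iff)
    qed
  qed
  moreover have "classical_prime_submodule (Q k) (R k) (M k)"
    using classical_prime_preimage_iff[OF k P Q[OF k] preimage] prime by blast
  moreover have "\<forall>t\<in>I - {k}. Q t = carrier (M t)" by (simp add: Q_def)
  ultimately show "\<exists>Q. ?product Q" using Q k by blast
next
  assume "\<exists>Q. ?product Q"
  then obtain Q k where Q: "\<And>i. i \<in> I \<Longrightarrow> submodule (Q i) (R i) (M i)"
    and product: "P = (\<Pi>\<^sub>E i\<in>I. Q i)" and k: "k \<in> I"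
    and prime: "classical_prime_submodule (Q k) (R k) (M k)"
    and full: "\<And>t. t \<in> I \<Longrightarrow> t \<noteq> k \<Longrightarrow> Q t = carrier (M t)"
    by blast
  have "x \<in> P \<longleftrightarrow> x k \<in> Q k" if "x \<in> carrier (product_module I M)" for x
    using that k full unfolding product by (auto simp: PiE_iff)
  then show ?prime using classical_prime_preimage_iff[OF k P Q[OF k]] prime by blast
qed

end

section \<open>The characterization\<close>

theorem theorem10:
  fixes n :: nat
    and A :: "nat \<Rightarrow> ('a, 'r) ring_scheme"
    and M :: "nat \<Rightarrow> ('a, 'b, 'm) module_scheme"
    and P :: "(nat \<Rightarrow> 'b) set"
  assumes "n \<ge> 2"
    and "\<And>i. i \<in> {1..n} \<Longrightarrow> cring (A i)"
    and "\<And>i. i \<in> {1..n} \<Longrightarrow> \<one>\<^bsub>A i\<^esub> \<noteq> \<zero>\<^bsub>A i\<^esub>"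
    and "\<And>i. i \<in> {1..n} \<Longrightarrow> module (A i) (M i)"
    and "\<And>i. i \<in> {1..n} \<Longrightarrow> carrier (M i) \<noteq> {\<zero>\<^bsub>M i\<^esub>}"
    and "submodule P (product_ring {1..n} A) (product_module {1..n} M)"
    and "P \<noteq> carrier (product_module {1..n} M)"
  shows "(classical_1_absorbing_prime_submodule P (product_ring {1..n} A) (product_module {1..n} M)
      \<longleftrightarrow>
      (\<exists>Q. (\<forall>i\<in>{1..n}. submodule (Q i) (A i) (M i)) \<and> P = (\<Pi>\<^sub>E i\<in>{1..n}. Q i) \<and>
        (\<exists>k\<in>{1..n}. classical_prime_submodule (Q k) (A k) (M k) \<and>
          (\<forall>t\<in>{1..n} - {k}. Q t = carrier (M t)))))
    \<and>
    (classical_1_absorbing_prime_submodule P (product_ring {1..n} A) (product_module {1..n} M)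
      \<longleftrightarrow>
      classical_prime_submodule P (product_ring {1..n} A) (product_module {1..n} M))"
proof -
  interpret product_of_modules "{1..n}" A M by (rule product_of_modules.intro) (rule assms(4))
  have "1 \<in> {1..n}" "2 \<in> {1..n}" using \<open>n \<ge> 2\<close> by auto
  then have absorbing_iff:
    "classical_1_absorbing_prime_submodule P (product_ring {1..n} A) (product_module {1..n} M)
      \<longleftrightarrow> classical_prime_submodule P (product_ring {1..n} A) (product_module {1..n} M)"
    using classical_1_absorbing_prime_iff_prime[of 1 2] assms(3) by simp
  show ?thesis
    unfolding absorbing_iff
    using classical_prime_iff_prime_in_one_factor[OF finite_atLeastAtMost assms(6)] by blast
qed

end
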